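(* Let $L>0$, let $d\ge 1$ be an integer, and let $(\eta_t)_{t=0}^{\infty}$ be the silver stepsize schedule for $L$-smooth functions. Then there is no function $\phi:\mathbb{N}\to[0,\infty)$ with $\lim_{T\to\infty}\phi(T)=0$ such that for every $L$-smooth convex function $f:\mathbb{R}^d\to\mathbb{R}$ that attains its infimum $f^*$, every minimizer $x^*$ of $f$, every initial point $x_0\in\mathbb{R}^d$, and every $T\in\mathbb{N}$, the gradient descent iterates $x_{t+1}=x_t-\eta_t\nabla f(x_t)$ satisfy $$f(x_T)-f^*\le L\,\|x_0-x^*\|^2\,\phi(T).$$
   Context: $\mathbb{N}=\{1,2,3,\dots\}$ and $\|\cdot\|$ is the Euclidean norm. A function $f:\mathbb{R}^d\to\mathbb{R}$ is $L$-smooth if it is differentiable and $\nabla f$ is $L$-Lipschitz. The silver stepsize schedule for $L$-smooth functions is $$\eta_t=\frac{1}{L}\left(1+\rho^{\,\nu(t+1)-1}\right),\qquad t=0,1,2,\dots,$$ where $\rho=1+\sqrt{2}$ and $\nu(i)$ is the largest integer $k\ge 0$ such that $2^k$ divides $i$. *)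

theory Defs
  imports "HOL-Analysis.Analysis" "HOL-Computational_Algebra.Primes"
begin

definition gradient :: "('a::real_inner \<Rightarrow> real) \<Rightarrow> 'a \<Rightarrow> 'a" where
  "gradient f x = (THE D. GDERIV f x :> D)"

lemma gradient_eqI:
  assumes "GDERIV f x :> D"
  shows "gradient f x = D"
  unfolding gradient_def
proof (rule the_equality)
  fix E
  assume "GDERIV f x :> E"
  then have "(\<lambda>h. h \<bullet> E) = (\<lambda>h. h \<bullet> D)"
    using assms unfolding gderiv_def by (rule has_derivative_unique)
  then have "(E - D) \<bullet> (E - D) = 0"
    by (metis inner_diff_right diff_self)
  then show "E = D"
    by simp
qed (fact assms)

definition smooth_with :: "real \<Rightarrow> ('a::real_inner \<Rightarrow> real) \<Rightarrow> bool" where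
  "smooth_with L f \<longleftrightarrow> (\<forall>x. f differentiable at x) \<and> L-lipschitz_on UNIV (gradient f)"

text \<open>
  The exponent is \<open>-1\<close> whenever \<^term>\<open>t + 1\<close> is odd, hence the integer power.
\<close>
definition silver_stepsize :: "real \<Rightarrow> nat \<Rightarrow> real" where
  "silver_stepsize L t = 1 / L * (1 + (1 + sqrt 2) powi (int (multiplicity 2 (t + 1)) - 1))"

end

theory Submission
  imports Defs
begin

text \<open>
  Uniform convergence fails at the times \<open>T = 2^k\<close>: the step taken just before, after \<open>2^k - 1\<close>
  steps, is so long that it can throw an almost converged iterate far past the minimizer.

  Take \<open>L = 1\<close> and one dimension, and put \<open>\<delta> = \<rho>^(-k)\<close>. Consider the convex function with derivative
  \<open>min x \<delta>\<close>, which is \<open>x\<^sup>2 / 2\<close> up to \<open>\<delta>\<close> and continues linearly from there; its minimizer is \<open>0\<close>.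
  The first \<open>2^k - 1\<close> silver steps add up to \<open>\<rho>^k - 1\<close> (\<open>sum_silver_stepsize\<close>), so gradient descent
  from \<open>x_0 = 1\<close> spends all of them on the linear part, whose gradient is \<open>\<delta>\<close>, and arrives exactly at
  \<open>1 - \<delta> (\<rho>^k - 1) = \<delta>\<close>. The next step has length \<open>1 + \<rho>^(k - 1)\<close> and leads to
  \<open>\<delta> - (1 + \<rho>^(k - 1)) \<delta> = -1/\<rho>\<close>, where the value is \<open>1 / (2 \<rho>\<^sup>2)\<close>, whatever \<open>k\<close> is
  (\<open>half_huber_overshoot\<close>). Hence every admissible \<open>\<phi>\<close> satisfies \<open>\<phi> (2^k) \<ge> 1 / (2 \<rho>\<^sup>2)\<close> for all
  \<open>k\<close> and cannot tend to zero. Scaling by \<open>L\<close> and composing with the inner product with a unit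
  vector carries the example over to every smoothness constant and every dimension.
\<close>

abbreviation silver_ratio :: real where
  "silver_ratio \<equiv> 1 + sqrt 2"

lemma silver_ratio_square: "silver_ratio * silver_ratio = 2 * silver_ratio + 1"
  by (simp add: algebra_simps)

lemma silver_ratio_pos: "silver_ratio > 0"
  by (simp add: add_pos_nonneg)

lemma silver_stepsize_nonneg: "0 < L \<Longrightarrow> 0 \<le> silver_stepsize L t"
  unfolding silver_stepsize_def using silver_ratio_pos by simp

text \<open>
  The \<open>2\<close>-adic valuation is periodic below \<open>2^k\<close>; this makes the schedule self-similar.
\<close>

lemma multiplicity_two_power_add:
  fixes j :: nat
  assumes "0 < j" "j < 2 ^ k"
  shows "multiplicity 2 (2 ^ k + j) = multiplicity 2 j"
proof -
  have "2 ^ multiplicity 2 j \<le> j"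
    using assms by (intro dvd_imp_le multiplicity_dvd)
  then have "(2::nat) ^ multiplicity 2 j < 2 ^ k"
    using assms by linarith
  then have "multiplicity 2 j < multiplicity 2 ((2::nat) ^ k)"
    by simp
  then have "multiplicity 2 (j + 2 ^ k) = multiplicity 2 j"
    using assms by (intro multiplicity_sum_lt) auto
  then show ?thesis
    by (simp add: add.commute)
qed

lemma silver_stepsize_two_power:
  "silver_stepsize L (2 ^ k - 1) = (1 + silver_ratio ^ k / silver_ratio) / L"
  using silver_ratio_pos by (simp add: silver_stepsize_def power_int_diff)

lemma sum_lessThan_add:
  fixes f :: "nat \<Rightarrow> 'a::comm_monoid_add"
  shows "sum f {..<m + n} = sum f {..<m} + (\<Sum>i<n. f (m + i))"
  by (induction n) (simp_all add: add.assoc)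

text \<open>
  The first \<open>2^(k+1) - 1\<close> steps are two copies of the first \<open>2^k - 1\<close> steps around the middle step
  \<open>1 + \<rho>^(k - 1)\<close>. The sums therefore satisfy \<open>S' = 2 S + 1 + \<rho>^(k - 1)\<close>, which \<open>S = \<rho>^k - 1\<close> solves
  because \<open>\<rho>\<^sup>2 = 2 \<rho> + 1\<close>.
\<close>

lemma sum_silver_stepsize:
  "(\<Sum>t<2 ^ k - 1. silver_stepsize L t) = (silver_ratio ^ k - 1) / L"
proof (induction k)
  case 0
  then show ?case by simp
next
  case (Suc k)
  let ?h = "silver_stepsize L" and ?n = "(2::nat) ^ k - 1"
  have split: "(2::nat) ^ Suc k - 1 = Suc ?n + ?n"
    using one_le_power[of "2::nat" k] by simp
  have periodic: "?h (Suc ?n + t) = ?h t" if "t < ?n" for t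
  proof -
    have "Suc ?n + t + 1 = 2 ^ k + (t + 1)"
      by simp
    moreover have "multiplicity 2 (2 ^ k + (t + 1)) = multiplicity 2 (t + 1)"
      using that by (intro multiplicity_two_power_add) auto
    ultimately show ?thesis
      unfolding silver_stepsize_def by metis
  qed
  have "(\<Sum>t<Suc ?n + ?n. ?h t) = (\<Sum>t<Suc ?n. ?h t) + (\<Sum>t<?n. ?h (Suc ?n + t))"
    by (rule sum_lessThan_add)
  also have "\<dots> = 2 * (\<Sum>t<?n. ?h t) + ?h ?n"
    using periodic unfolding sum.lessThan_Suc by simp
  also have "\<dots> = (2 * silver_ratio ^ k - 1 + silver_ratio ^ k / silver_ratio) / L"
    unfolding Suc.IH silver_stepsize_two_power by (simp add: diff_divide_distrib add_divide_distrib)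
  also have "2 * silver_ratio ^ k - 1 + silver_ratio ^ k / silver_ratio
      = silver_ratio ^ k * ((2 * silver_ratio + 1) / silver_ratio) - 1"
    using silver_ratio_pos by (simp add: field_simps)
  also have "(2 * silver_ratio + 1) / silver_ratio = silver_ratio"
    unfolding silver_ratio_square[symmetric] using silver_ratio_pos by simp
  finally show ?case
    unfolding split by (simp add: mult.commute)
qed

text \<open>
  One half of a Huber function. The Huber function itself, linear with slope \<open>-\<delta>\<close> to the left of
  \<open>-\<delta>\<close>, would have a value of order \<open>\<delta>\<close> after the overshoot, and \<open>\<delta>\<close> tends to zero. Keeping the
  quadratic on the whole left side makes that value independent of \<open>\<delta>\<close>.
\<close>

definition half_huber :: "real \<Rightarrow> real \<Rightarrow> real" where
  "half_huber \<delta> x = (if x \<le> \<delta> then x\<^sup>2 / 2 else \<delta> * x - \<delta>\<^sup>2 / 2)"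

text \<open>
  A quadratic bound on the linearization error gives differentiability everywhere at once, so that the
  junction \<open>x = \<delta>\<close> needs no one-sided limits.
\<close>

lemma half_huber_linearization_error:
  "\<bar>half_huber \<delta> y - half_huber \<delta> x - min x \<delta> * (y - x)\<bar> \<le> (y - x)\<^sup>2"
proof -
  have sq: "0 \<le> (y - x)\<^sup>2" "0 \<le> (y - \<delta>)\<^sup>2" "0 \<le> (x - \<delta>)\<^sup>2" by simp_all
  consider "x \<le> \<delta>" "y \<le> \<delta>" | "x \<le> \<delta>" "\<delta> < y" | "\<delta> < x" "y \<le> \<delta>" | "\<delta> < x" "\<delta> < y"
    by linarith
  then show ?thesis
  proof cases
    case 2
    have "0 \<le> (y - \<delta>) * (\<delta> - x)" using 2 by simp
    then show ?thesis
      using 2 sq by (simp add: half_huber_def abs_le_iff power2_eq_square algebra_simps; linarith)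
  next
    case 3
    have "0 \<le> (\<delta> - y) * (x - \<delta>)" using 3 by simp
    then show ?thesis
      using 3 sq by (simp add: half_huber_def abs_le_iff power2_eq_square algebra_simps; linarith)
  next
    case 1
    then show ?thesis
      using sq by (simp add: half_huber_def abs_le_iff power2_eq_square algebra_simps; linarith?)
  next
    case 4
    then show ?thesis
      using sq by (simp add: half_huber_def algebra_simps)
  qed
qed

lemma half_huber_has_real_derivative:
  "(half_huber \<delta> has_real_derivative min x \<delta>) (at x)"
  unfolding has_field_derivative_iff
proof (subst LIM_zero_iff[symmetric], rule Lim_null_comparison)
  show "\<forall>\<^sub>F y in at x. norm ((half_huber \<delta> y - half_huber \<delta> x) / (y - x) - min x \<delta>) \<le> \<bar>y - x\<bar>"
  proof (rule eventually_mono[OF eventually_neq_at_within])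
    fix y assume "y \<noteq> x"
    then have "(half_huber \<delta> y - half_huber \<delta> x) / (y - x) - min x \<delta>
        = (half_huber \<delta> y - half_huber \<delta> x - min x \<delta> * (y - x)) / (y - x)"
      by (simp add: diff_divide_distrib)
    moreover have "\<bar>half_huber \<delta> y - half_huber \<delta> x - min x \<delta> * (y - x)\<bar> \<le> \<bar>y - x\<bar> * \<bar>y - x\<bar>"
      using half_huber_linearization_error[of \<delta> y x] by (simp add: power2_eq_square)
    ultimately show "norm ((half_huber \<delta> y - half_huber \<delta> x) / (y - x) - min x \<delta>) \<le> \<bar>y - x\<bar>"
      using \<open>y \<noteq> x\<close> by (simp add: pos_divide_le_eq)
  qed
  show "((\<lambda>y. \<bar>y - x\<bar>) \<longlongrightarrow> 0) (at x)"
    by (auto intro!: tendsto_eq_intros)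
qed

lemma convex_half_huber: "convex_on UNIV (half_huber \<delta>)"
  by (rule convex_on_realI[OF _ half_huber_has_real_derivative]) auto

lemma half_huber_nonneg: "0 \<le> \<delta> \<Longrightarrow> 0 \<le> half_huber \<delta> x"
  unfolding half_huber_def power2_eq_square
  by (smt (verit) mult_left_mono mult_nonneg_nonneg zero_le_square field_sum_of_halves)

text \<open>
  Every partial sum of the first \<open>2^k - 1\<close> steps is at most the full one, so the iterates stay on the
  linear part until they reach its end \<open>\<delta>\<close>, from where the long step sends them to \<open>-1/\<rho>\<close>. Here \<open>u\<close>
  will be the coordinate of gradient descent along a fixed direction.
\<close>

lemma half_huber_overshoot:
  fixes u :: "nat \<Rightarrow> real"
  assumes "0 < L"
    and \<delta>: "\<delta> = inverse (silver_ratio ^ k)"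
    and start: "u 0 = 1"
    and step: "\<And>t. u (Suc t) = u t - L * silver_stepsize L t * min (u t) \<delta>"
  shows "u (2 ^ k) = - inverse silver_ratio"
proof -
  let ?S = "\<lambda>t. \<Sum>s<t. silver_stepsize L s" and ?n = "(2::nat) ^ k - 1"
  have \<delta>_pos: "0 < \<delta>" and \<delta>_cancel: "\<delta> * silver_ratio ^ k = 1"
    using silver_ratio_pos by (simp_all add: \<delta>)
  have S_n: "L * ?S ?n = silver_ratio ^ k - 1"
    unfolding sum_silver_stepsize using \<open>0 < L\<close> by simp
  have linear_part: "\<delta> \<le> 1 - \<delta> * (L * ?S t)" if "t \<le> ?n" for t
  proof -
    have "?S t \<le> ?S ?n"
      using that silver_stepsize_nonneg[OF \<open>0 < L\<close>] by (intro sum_mono2) auto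
    then have "\<delta> * (L * ?S t) \<le> \<delta> * (L * ?S ?n)"
      using \<open>0 < L\<close> \<delta>_pos by (intro mult_left_mono) auto
    also have "\<dots> = 1 - \<delta>"
      unfolding S_n using \<delta>_cancel by (simp add: algebra_simps)
    finally show ?thesis by simp
  qed
  have "u t = 1 - \<delta> * (L * ?S t)" if "t \<le> ?n" for t
    using that
  proof (induction t)
    case 0
    then show ?case by (simp add: start)
  next
    case (Suc t)
    then have "u t = 1 - \<delta> * (L * ?S t)" and "min (u t) \<delta> = \<delta>"
      using linear_part[of t] by auto
    then show ?case
      by (simp add: step algebra_simps)
  qed
  from this[of ?n] have "u ?n = \<delta>"
    unfolding S_n using \<delta>_cancel by (simp add: algebra_simps)
  moreover have "u (2 ^ k) = u ?n - L * silver_stepsize L ?n * min (u ?n) \<delta>"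
    using step[of ?n] by simp
  ultimately have "u (2 ^ k) = \<delta> - (1 + silver_ratio ^ k / silver_ratio) * \<delta>"
    unfolding silver_stepsize_two_power using \<open>0 < L\<close> by simp
  also have "\<dots> = - (\<delta> * silver_ratio ^ k) / silver_ratio"
    by (simp add: algebra_simps)
  finally show ?thesis
    unfolding \<delta>_cancel by (simp add: divide_inverse)
qed

lemma GDERIV_half_huber_inner:
  fixes e :: "'a::real_inner"
  shows "GDERIV (\<lambda>x. L * half_huber \<delta> (x \<bullet> e)) x :> (L * min (x \<bullet> e) \<delta>) *\<^sub>R e"
proof -
  have "((\<lambda>x. half_huber \<delta> (x \<bullet> e)) has_derivative (\<lambda>h. min (x \<bullet> e) \<delta> * (h \<bullet> e))) (at x)"
    by (rule has_derivative_compose[OF _ half_huber_has_real_derivative[unfolded has_field_derivative_def], where f = "\<lambda>x. x \<bullet> e"])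
       (auto intro!: derivative_eq_intros)
  then show ?thesis
    unfolding gderiv_def by (auto intro!: derivative_eq_intros simp: algebra_simps)
qed

lemma gradient_half_huber_inner:
  fixes e :: "'a::real_inner"
  shows "gradient (\<lambda>x. L * half_huber \<delta> (x \<bullet> e)) x = (L * min (x \<bullet> e) \<delta>) *\<^sub>R e"
  by (rule gradient_eqI[OF GDERIV_half_huber_inner])

lemma smooth_with_half_huber_inner:
  fixes e :: "'a::real_inner"
  assumes "0 \<le> L" "norm e = 1"
  shows "smooth_with L (\<lambda>x. L * half_huber \<delta> (x \<bullet> e))"
  unfolding smooth_with_def
proof (intro conjI allI lipschitz_onI \<open>0 \<le> L\<close>)
  show "(\<lambda>x. L * half_huber \<delta> (x \<bullet> e)) differentiable at x" for x
    using GDERIV_half_huber_inner[of L \<delta> e x] unfolding gderiv_def differentiable_def by blast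
  fix x y :: 'a
  have "\<bar>min (x \<bullet> e) \<delta> - min (y \<bullet> e) \<delta>\<bar> \<le> \<bar>(x - y) \<bullet> e\<bar>"
    by (auto simp: inner_diff_left)
  also have "\<dots> \<le> norm (x - y)"
    using Cauchy_Schwarz_ineq2[of "x - y" e] assms(2) by simp
  finally have "L * \<bar>min (x \<bullet> e) \<delta> - min (y \<bullet> e) \<delta>\<bar> \<le> L * norm (x - y)"
    using assms(1) by (rule mult_left_mono)
  then show "dist (gradient (\<lambda>x. L * half_huber \<delta> (x \<bullet> e)) x)
      (gradient (\<lambda>x. L * half_huber \<delta> (x \<bullet> e)) y) \<le> L * dist x y"
    using assms by (simp add: gradient_half_huber_inner dist_norm abs_mult
        flip: scaleR_diff_left right_diff_distrib)
qed

lemma convex_half_huber_inner: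
  fixes e :: "'a::real_inner"
  assumes "0 \<le> L"
  shows "convex_on UNIV (\<lambda>x. L * half_huber \<delta> (x \<bullet> e))"
proof (rule convex_on_cmul[OF assms], rule convex_onI)
  fix t :: real and x y :: 'a
  assume "0 < t" "t < 1"
  then show "half_huber \<delta> (((1 - t) *\<^sub>R x + t *\<^sub>R y) \<bullet> e)
      \<le> (1 - t) * half_huber \<delta> (x \<bullet> e) + t * half_huber \<delta> (y \<bullet> e)"
    using convex_onD[OF convex_half_huber, of t "x \<bullet> e" "y \<bullet> e" \<delta>]
    by (simp add: inner_add_left)
qed simp

theorem corollary4:
  fixes L :: real
  assumes "L > 0"
  shows "\<nexists>\<phi> :: nat \<Rightarrow> real.
    (\<forall>T\<ge>1. \<phi> T \<ge> 0) \<and> \<phi> \<longlonglongrightarrow> 0 \<and>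
    (\<forall>(f :: real ^ 'd \<Rightarrow> real) xstar (x :: nat \<Rightarrow> real ^ 'd).
      smooth_with L f \<longrightarrow> convex_on UNIV f \<longrightarrow>
      is_arg_min f (\<lambda>_. True) xstar \<longrightarrow>
      (\<forall>t. x (Suc t) = x t - silver_stepsize L t *\<^sub>R gradient f (x t)) \<longrightarrow>
      (\<forall>T\<ge>1. f (x T) - (INF y. f y) \<le> L * (norm (x 0 - xstar))\<^sup>2 * \<phi> T))"
proof
  assume "\<exists>\<phi> :: nat \<Rightarrow> real.
    (\<forall>T\<ge>1. \<phi> T \<ge> 0) \<and> \<phi> \<longlonglongrightarrow> 0 \<and>
    (\<forall>(f :: real ^ 'd \<Rightarrow> real) xstar (x :: nat \<Rightarrow> real ^ 'd).
      smooth_with L f \<longrightarrow> convex_on UNIV f \<longrightarrow>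
      is_arg_min f (\<lambda>_. True) xstar \<longrightarrow>
      (\<forall>t. x (Suc t) = x t - silver_stepsize L t *\<^sub>R gradient f (x t)) \<longrightarrow>
      (\<forall>T\<ge>1. f (x T) - (INF y. f y) \<le> L * (norm (x 0 - xstar))\<^sup>2 * \<phi> T))"
  then obtain \<phi> :: "nat \<Rightarrow> real" where lim: "\<phi> \<longlonglongrightarrow> 0"
    and rate: "\<And>(f :: real ^ 'd \<Rightarrow> real) xstar x T. smooth_with L f \<Longrightarrow> convex_on UNIV f \<Longrightarrow>
      is_arg_min f (\<lambda>_. True) xstar \<Longrightarrow>
      \<forall>t. x (Suc t) = x t - silver_stepsize L t *\<^sub>R gradient f (x t) \<Longrightarrow> 1 \<le> T \<Longrightarrow>
      f (x T) - (INF y. f y) \<le> L * (norm (x 0 - xstar))\<^sup>2 * \<phi> T"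
    by blast
  let ?c = "(inverse silver_ratio)\<^sup>2 / 2"
  have "?c \<le> \<phi> (2 ^ k)" for k
  proof -
    define \<delta> where "\<delta> = inverse (silver_ratio ^ k)"
    obtain e :: "real ^ 'd" where e: "norm e = 1"
      using vector_choose_size[of 1] by auto
    define f :: "real ^ 'd \<Rightarrow> real" where "f = (\<lambda>x. L * half_huber \<delta> (x \<bullet> e))"
    define x where "x = rec_nat e (\<lambda>t y. y - silver_stepsize L t *\<^sub>R gradient f y)"
    have x_0: "x 0 = e" and x_Suc: "\<And>t. x (Suc t) = x t - silver_stepsize L t *\<^sub>R gradient f (x t)"
      by (simp_all add: x_def)
    have "0 < \<delta>"
      using silver_ratio_pos by (simp add: \<delta>_def)
    then have f_nonneg: "0 \<le> f y" and f_0: "f 0 = 0" for y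
      using assms half_huber_nonneg[of \<delta>] by (simp_all add: f_def half_huber_def)
    have "e \<bullet> e = 1"
      using e by (simp add: norm_eq_1)
    then have "x (Suc t) \<bullet> e = x t \<bullet> e - L * silver_stepsize L t * min (x t \<bullet> e) \<delta>" for t
      unfolding x_Suc f_def gradient_half_huber_inner by (simp add: inner_diff_left)
    with \<open>e \<bullet> e = 1\<close> have "x (2 ^ k) \<bullet> e = - inverse silver_ratio"
      using half_huber_overshoot[OF assms \<delta>_def, of "\<lambda>t. x t \<bullet> e"] by (simp add: x_0)
    moreover have "- inverse silver_ratio \<le> \<delta>"
      using \<open>0 < \<delta>\<close> silver_ratio_pos
      by (smt (verit) inverse_positive_iff_positive)
    ultimately have "f (x (2 ^ k)) = L * ?c"
      by (simp add: f_def half_huber_def)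
    moreover have "(INF y. f y) \<le> 0"
      using f_nonneg f_0 by (intro cINF_lower2[of _ _ 0]) (auto intro!: bdd_belowI2)
    moreover have "f (x (2 ^ k)) - (INF y. f y) \<le> L * (norm (x 0 - 0))\<^sup>2 * \<phi> (2 ^ k)"
    proof (rule rate)
      show "smooth_with L f" "convex_on UNIV f"
        using assms e unfolding f_def
        by (simp_all add: smooth_with_half_huber_inner convex_half_huber_inner)
      show "is_arg_min f (\<lambda>_. True) 0"
        using f_nonneg by (simp add: is_arg_min_linorder f_0)
    qed (simp_all add: x_Suc)
    ultimately have "L * ?c \<le> L * \<phi> (2 ^ k)"
      by (simp add: x_0 e)
    then show ?thesis
      using assms by (simp only: mult_le_cancel_left_pos)
  qed
  moreover have "(\<lambda>k. \<phi> (2 ^ k)) \<longlonglongrightarrow> 0"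
    using LIMSEQ_subseq_LIMSEQ[OF lim, of "\<lambda>k. 2 ^ k"] by (simp add: strict_mono_def o_def)
  ultimately have "?c \<le> 0"
    by (intro LIMSEQ_le_const) auto
  then show False
    using silver_ratio_pos by simp
qed

end
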